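(* Let $v$ be a valuation on a field $F$ with value group $\Gamma_v$ and valuation ring $O_v$, let $\mathcal M(\Gamma_v)$ be the cut monoid of $\Gamma_v$, let $R$ be a torsion free algebra over $O_v$, and let $w:R\to\mathcal M(\Gamma_v)\cup\{\infty\}$ be the filter quasi-valuation induced by $(R,v)$. Then there exists a quasi-valuation $W:R\otimes_{O_v}F\to\mathcal M(\Gamma_v)\cup\{\infty\}$ extending $w$ (where $R$ is identified with $R\otimes_{O_v}1$, i.e. $W(r\otimes1)=w(r)$ for all $r\in R$) and such that $O_W=\{x\in R\otimes_{O_v}F\mid W(x)\ge0\}$ equals $R\otimes_{O_v}1$.
   Context: A totally ordered abelian monoid is a commutative monoid $(M,+)$ with a total order such that $a\le b$ implies $a+c\le b+c$. One adjoins $\infty$, greater than all elements of $M$, with $m+\infty=\infty$. A quasi-valuation on a ring $A$ is a function $w:A\to M\cup\{\infty\}$, $M$ a totally ordered abelian monoid, with $w(0)=\infty$, $w(xy)\ge w(x)+w(y)$ and $w(x+y)\ge\min\{w(x),w(y)\}$ for all $x,y\in A$. Cut monoid. For a totally ordered abelian group $\Gamma$, a cut $\mathcal A=(\mathcal A^L,\mathcal A^R)$ is a partition of $\Gamma$ into two (possibly empty) subsets with $\alpha<\beta$ for all $\alpha\in\mathcal A^L,\beta\in\mathcal A^R$. $\mathcal M(\Gamma)$ is the set of all cuts, ordered by $\mathcal A\le\mathcal B$ iff $\mathcal A^L\subseteq\mathcal B^L$, with addition $(\mathcal A+\mathcal B)^L=\{\alpha+\beta\mid\alpha\in\mathcal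 A^L,\beta\in\mathcal B^L\}$; it is a totally ordered abelian monoid with zero element $((-\infty,0],(0,\infty))$. For $S\subseteq\Gamma$, $S^+$ is the smallest cut $\mathcal A$ with $S\subseteq\mathcal A^L$. The adjoined $\infty$ is different from (and greater than) the cut $(\Gamma,\emptyset)$. Filter quasi-valuation. For an $O_v$-algebra $R$ (associative with $1$) and $x\in R$ let $S_x=\{a\in O_v\mid xR\subseteq aR\}$. The filter quasi-valuation on $R$ induced by $(R,v)$ is $w:R\to\mathcal M(\Gamma_v)\cup\{\infty\}$, $w(0)=\infty$ and $w(x)=v(S_x)^+$ for $x\ne0$, where $v(S_x)=\{v(a)\mid a\in S_x\}$. *)

theory Defs
  imports "HOL-Algebra.Algebra"
begin

section \<open>Adjoining a largest absorbing element\<close>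

datatype 'm with_top = Fin 'm | Top

instantiation with_top :: (linorder) linorder
begin

definition less_eq_with_top :: "'a with_top \<Rightarrow> 'a with_top \<Rightarrow> bool" where
  "x \<le> y \<longleftrightarrow> (case y of Top \<Rightarrow> True | Fin b \<Rightarrow> (case x of Top \<Rightarrow> False | Fin a \<Rightarrow> a \<le> b))"

definition less_with_top :: "'a with_top \<Rightarrow> 'a with_top \<Rightarrow> bool" where
  "x < y \<longleftrightarrow> x \<le> y \<and> \<not> y \<le> (x :: 'a with_top)"

instance
  by standard (auto simp: less_eq_with_top_def less_with_top_def split: with_top.splits)

end

instantiation with_top :: (comm_monoid_add) comm_monoid_add
begin

definition zero_with_top :: "'a with_top" where
  "0 = Fin 0"

definition plus_with_top :: "'a with_top \<Rightarrow> 'a with_top \<Rightarrow> 'a with_top" where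
  "x + y = (case x of Top \<Rightarrow> Top | Fin a \<Rightarrow> (case y of Top \<Rightarrow> Top | Fin b \<Rightarrow> Fin (a + b)))"

instance
  by standard (auto simp: zero_with_top_def plus_with_top_def ac_simps split: with_top.splits)

end


section \<open>The cut monoid of a totally ordered abelian group\<close>

text \<open>A cut is the pair of its left and right part; either may be empty.\<close>

typedef (overloaded) ('g :: linordered_ab_group_add) cut =
  "{(L, R). L \<union> R = (UNIV :: 'g set) \<and> L \<inter> R = {} \<and> (\<forall>\<alpha>\<in>L. \<forall>\<beta>\<in>R. \<alpha> < \<beta>)}"
  by (rule exI[of _ "({}, UNIV)"]) auto

definition cut_left :: "'g::linordered_ab_group_add cut \<Rightarrow> 'g set" where
  "cut_left A = fst (Rep_cut A)"

definition cut_right :: "'g::linordered_ab_group_add cut \<Rightarrow> 'g set" where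
  "cut_right A = snd (Rep_cut A)"

text \<open>The cut with prescribed left part (meaningful for downward closed sets).\<close>

definition cut_of_left :: "'g::linordered_ab_group_add set \<Rightarrow> 'g cut" where
  "cut_of_left L = Abs_cut (L, - L)"

lemma cut_right_eq: "cut_right A = - cut_left A"
  using Rep_cut[of A] by (auto simp: cut_left_def cut_right_def)

lemma cut_left_down:
  assumes "\<alpha> \<in> cut_left A" "\<beta> \<le> \<alpha>"
  shows "\<beta> \<in> cut_left A"
proof (rule ccontr)
  assume "\<beta> \<notin> cut_left A"
  then have "\<beta> \<in> cut_right A" by (simp add: cut_right_eq)
  then have "\<alpha> < \<beta>"
    using Rep_cut[of A] assms by (auto simp: cut_left_def cut_right_def)
  with assms(2) show False by simp
qed

lemma cut_left_inject: "cut_left A = cut_left B \<longleftrightarrow> A = B"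
  using cut_right_eq[of A] cut_right_eq[of B]
  by (metis Rep_cut_inject cut_left_def cut_right_def prod.collapse)

lemma cut_left_of_left:
  assumes "\<And>\<alpha> \<beta>. \<alpha> \<in> L \<Longrightarrow> \<beta> \<le> \<alpha> \<Longrightarrow> \<beta> \<in> L"
  shows "cut_left (cut_of_left L) = L"
proof -
  have "\<forall>\<alpha>\<in>L. \<forall>\<beta>\<in>- L. \<alpha> < \<beta>"
    using assms by (meson ComplD leI)
  then show ?thesis
    by (simp add: cut_left_def cut_of_left_def Abs_cut_inverse)
qed

instantiation cut :: (linordered_ab_group_add) linorder
begin

definition less_eq_cut :: "'a cut \<Rightarrow> 'a cut \<Rightarrow> bool" where
  "A \<le> B \<longleftrightarrow> cut_left A \<subseteq> cut_left B"

definition less_cut :: "'a cut \<Rightarrow> 'a cut \<Rightarrow> bool" where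
  "A < B \<longleftrightarrow> A \<le> B \<and> \<not> B \<le> (A :: 'a cut)"

instance
proof
  fix A B :: "'a cut"
  show "A \<le> B \<or> B \<le> A"
    unfolding less_eq_cut_def by (meson cut_left_down linear subsetI)
qed (auto simp: less_eq_cut_def less_cut_def cut_left_inject[symmetric])

end

instantiation cut :: (linordered_ab_group_add) ordered_comm_monoid_add
begin

definition zero_cut :: "'a cut" where
  "0 = cut_of_left {..0}"

definition plus_cut :: "'a cut \<Rightarrow> 'a cut \<Rightarrow> 'a cut" where
  "A + B = cut_of_left {\<alpha> + \<beta> |\<alpha> \<beta>. \<alpha> \<in> cut_left A \<and> \<beta> \<in> cut_left B}"

lemma cut_left_zero: "cut_left (0 :: 'a cut) = {..0}"
  unfolding zero_cut_def by (rule cut_left_of_left) auto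

lemma cut_left_plus:
  "cut_left (A + B) = {\<alpha> + \<beta> |\<alpha> \<beta>. \<alpha> \<in> cut_left A \<and> \<beta> \<in> cut_left (B :: 'a cut)}"
  unfolding plus_cut_def
proof (rule cut_left_of_left)
  fix \<gamma> \<delta> :: 'a
  assume "\<gamma> \<in> {\<alpha> + \<beta> |\<alpha> \<beta>. \<alpha> \<in> cut_left A \<and> \<beta> \<in> cut_left B}" and le: "\<delta> \<le> \<gamma>"
  then obtain \<alpha> \<beta> where *: "\<gamma> = \<alpha> + \<beta>" "\<alpha> \<in> cut_left A" "\<beta> \<in> cut_left B" by auto
  have "\<delta> - \<beta> \<in> cut_left A"
    using cut_left_down[OF *(2)] le *(1) by (simp add: algebra_simps)
  moreover have "\<delta> = (\<delta> - \<beta>) + \<beta>" by simp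
  ultimately show "\<delta> \<in> {\<alpha> + \<beta> |\<alpha> \<beta>. \<alpha> \<in> cut_left A \<and> \<beta> \<in> cut_left B}"
    using *(3) by blast
qed

instance
proof
  fix A B C :: "'a cut"
  show "A + B + C = A + (B + C)"
    unfolding cut_left_inject[symmetric] cut_left_plus
    by (auto simp: add.assoc) (metis add.assoc)+
  show "A + B = B + A"
    unfolding cut_left_inject[symmetric] cut_left_plus
    by (auto; metis add.commute)
  show "0 + A = A"
  proof -
    have "{\<alpha> + \<beta> |\<alpha> \<beta>. \<alpha> \<in> {..0} \<and> \<beta> \<in> cut_left A} = cut_left A"
    proof (intro equalityI subsetI)
      fix x assume "x \<in> cut_left A"
      then show "x \<in> {\<alpha> + \<beta> |\<alpha> \<beta>. \<alpha> \<in> {..0} \<and> \<beta> \<in> cut_left A}"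
        by (intro CollectI exI[of _ 0] exI[of _ x]) auto
    next
      fix x assume "x \<in> {\<alpha> + \<beta> |\<alpha> \<beta>. \<alpha> \<in> {..0} \<and> \<beta> \<in> cut_left A}"
      then obtain \<alpha> \<beta> where "x = \<alpha> + \<beta>" "\<alpha> \<le> 0" "\<beta> \<in> cut_left A" by auto
      then show "x \<in> cut_left A"
        using cut_left_down[of \<beta> A x] by (simp add: add_le_cancel_right)
    qed
    then show ?thesis
      unfolding cut_left_inject[symmetric] cut_left_plus cut_left_zero .
  qed
  show "A \<le> B \<Longrightarrow> C + A \<le> C + B"
    unfolding less_eq_cut_def cut_left_plus by blast
qed

end

text \<open>\<open>S\<^sup>+\<close>, the smallest cut whose left part contains \<open>S\<close>; it exists for every \<open>S\<close> by the
  lemma below.\<close>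

definition cut_plus :: "'g::linordered_ab_group_add set \<Rightarrow> 'g cut" where
  "cut_plus S = (LEAST A. S \<subseteq> cut_left A)"

lemma cut_left_cut_plus: "cut_left (cut_plus S) = {\<alpha>. \<exists>\<sigma>\<in>S. \<alpha> \<le> \<sigma>}"
proof -
  let ?D = "{\<alpha>. \<exists>\<sigma>\<in>S. \<alpha> \<le> \<sigma>}"
  have D: "cut_left (cut_of_left ?D) = ?D"
    by (rule cut_left_of_left) (blast intro: order_trans)
  have "cut_plus S = cut_of_left ?D"
    unfolding cut_plus_def
  proof (rule Least_equality)
    show "S \<subseteq> cut_left (cut_of_left ?D)" unfolding D by blast
    show "cut_of_left ?D \<le> A" if "S \<subseteq> cut_left A" for A
      using that unfolding less_eq_cut_def D by (blast intro: cut_left_down)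
  qed
  with D show ?thesis by simp
qed


section \<open>Valuations and quasi-valuations\<close>

text \<open>The value group of \<open>v\<close> is by definition \<open>v(F - {0})\<close>; here it is the whole type
  \<open>'g\<close>, i.e. \<open>v\<close> is surjective.\<close>

locale valuation = field F for F (structure) +
  fixes v :: "'a \<Rightarrow> 'g::linordered_ab_group_add with_top"
  assumes val_eq_Top_iff: "x \<in> carrier F \<Longrightarrow> v x = Top \<longleftrightarrow> x = \<zero>"
    and val_mult: "\<lbrakk>x \<in> carrier F; y \<in> carrier F\<rbrakk> \<Longrightarrow> v (x \<otimes> y) = v x + v y"
    and val_add: "\<lbrakk>x \<in> carrier F; y \<in> carrier F\<rbrakk> \<Longrightarrow> min (v x) (v y) \<le> v (x \<oplus> y)"
    and val_group: "v ` (carrier F - {\<zero>}) = range Fin"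

definition valuation_ring ::
    "('a, 'm) ring_scheme \<Rightarrow> ('a \<Rightarrow> 'g::linordered_ab_group_add with_top) \<Rightarrow> ('a, 'm) ring_scheme"
  where "valuation_ring F v = F\<lparr>carrier := {x \<in> carrier F. 0 \<le> v x}\<rparr>"

definition quasi_valuation ::
    "('a, 'm) ring_scheme \<Rightarrow> ('a \<Rightarrow> 'c::{linorder, ordered_comm_monoid_add} with_top) \<Rightarrow> bool"
  where "quasi_valuation R w \<longleftrightarrow>
    w \<zero>\<^bsub>R\<^esub> = Top \<and>
    (\<forall>x\<in>carrier R. \<forall>y\<in>carrier R. w x + w y \<le> w (x \<otimes>\<^bsub>R\<^esub> y)) \<and>
    (\<forall>x\<in>carrier R. \<forall>y\<in>carrier R. min (w x) (w y) \<le> w (x \<oplus>\<^bsub>R\<^esub> y))"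


section \<open>Algebras and their tensor products\<close>

text \<open>Unlike the library's locale \<open>algebra\<close>, the ring \<open>M\<close> need not be commutative.\<close>

locale assoc_algebra = module R M + ring M for R and M (structure) +
  assumes smult_mult_left: "\<lbrakk>a \<in> carrier R; x \<in> carrier M; y \<in> carrier M\<rbrakk>
      \<Longrightarrow> (a \<odot> x) \<otimes> y = a \<odot> (x \<otimes> y)"
    and smult_mult_right: "\<lbrakk>a \<in> carrier R; x \<in> carrier M; y \<in> carrier M\<rbrakk>
      \<Longrightarrow> x \<otimes> (a \<odot> y) = a \<odot> (x \<otimes> y)"

definition torsion_free :: "('a, 'm) ring_scheme \<Rightarrow> ('a, 'b, 'n) module_scheme \<Rightarrow> bool" where
  "torsion_free A M \<longleftrightarrow>
    (\<forall>a\<in>carrier A. \<forall>x\<in>carrier M. a \<odot>\<^bsub>M\<^esub> x = \<zero>\<^bsub>M\<^esub> \<longrightarrow> a = \<zero>\<^bsub>A\<^esub> \<or> x = \<zero>\<^bsub>M\<^esub>)"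

text \<open>A ring acting on itself (and hence each of its subrings acting on it) by multiplication.\<close>

definition self_module :: "('a, 'm) ring_scheme \<Rightarrow> ('a, 'a) module" where
  "self_module F = \<lparr>carrier = carrier F, monoid.mult = monoid.mult F, one = one F,
    ring.zero = ring.zero F, add = add F, smult = monoid.mult F\<rparr>"

text \<open>The free abelian group on the pairs \<open>(m, n)\<close>, with the ring structure determined by
  \<open>(m, n) (m', n') = (m m', n n')\<close>.\<close>

definition pair_ring ::
    "('b, 'm) ring_scheme \<Rightarrow> ('c, 'n) ring_scheme \<Rightarrow> ('b \<times> 'c \<Rightarrow>\<^sub>0 int) ring" where
  "pair_ring M N =
    \<lparr>carrier = {c. Poly_Mapping.keys c \<subseteq> carrier M \<times> carrier N},
     monoid.mult = (\<lambda>x y. frag_extend (\<lambda>(m, n). frag_extend (\<lambda>(m', n').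
       frag_of (m \<otimes>\<^bsub>M\<^esub> m', n \<otimes>\<^bsub>N\<^esub> n')) y) x),
     one = frag_of (\<one>\<^bsub>M\<^esub>, \<one>\<^bsub>N\<^esub>), ring.zero = 0, add = (+)\<rparr>"

definition tensor_relators :: "('a, 'k) ring_scheme \<Rightarrow> ('a, 'b, 'm) module_scheme \<Rightarrow>
    ('a, 'c, 'n) module_scheme \<Rightarrow> ('b \<times> 'c \<Rightarrow>\<^sub>0 int) set" where
  "tensor_relators A M N =
    {frag_of (m \<oplus>\<^bsub>M\<^esub> m', n) - frag_of (m, n) - frag_of (m', n) |m m' n.
       m \<in> carrier M \<and> m' \<in> carrier M \<and> n \<in> carrier N} \<union>
    {frag_of (m, n \<oplus>\<^bsub>N\<^esub> n') - frag_of (m, n) - frag_of (m, n') |m n n'.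
       m \<in> carrier M \<and> n \<in> carrier N \<and> n' \<in> carrier N} \<union>
    {frag_of (a \<odot>\<^bsub>M\<^esub> m, n) - frag_of (m, a \<odot>\<^bsub>N\<^esub> n) |a m n.
       a \<in> carrier A \<and> m \<in> carrier M \<and> n \<in> carrier N}"

text \<open>The additive subgroup generated by the bilinearity relators. If \<open>M\<close> and \<open>N\<close> are
  \<open>A\<close>-algebras it is a two-sided ideal of the pair ring, so that the quotient below is the usual
  tensor product of modules with multiplication \<open>(m \<otimes> n) (m' \<otimes> n') = m m' \<otimes> n n'\<close>.\<close>

definition tensor_kernel :: "('a, 'k) ring_scheme \<Rightarrow> ('a, 'b, 'm) module_scheme \<Rightarrow>
    ('a, 'c, 'n) module_scheme \<Rightarrow> ('b \<times> 'c \<Rightarrow>\<^sub>0 int) set" where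
  "tensor_kernel A M N = generate (add_monoid (pair_ring M N)) (tensor_relators A M N)"

definition tensor_algebra :: "('a, 'k) ring_scheme \<Rightarrow> ('a, 'b, 'm) module_scheme \<Rightarrow>
    ('a, 'c, 'n) module_scheme \<Rightarrow> ('b \<times> 'c \<Rightarrow>\<^sub>0 int) set ring" where
  "tensor_algebra A M N = pair_ring M N Quot tensor_kernel A M N"

definition pure_tensor :: "('a, 'k) ring_scheme \<Rightarrow> ('a, 'b, 'm) module_scheme \<Rightarrow>
    ('a, 'c, 'n) module_scheme \<Rightarrow> 'b \<Rightarrow> 'c \<Rightarrow> ('b \<times> 'c \<Rightarrow>\<^sub>0 int) set" where
  "pure_tensor A M N m n = tensor_kernel A M N +>\<^bsub>pair_ring M N\<^esub> frag_of (m, n)"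


section \<open>The filter quasi-valuation\<close>

definition filter_set :: "('a, 'k) ring_scheme \<Rightarrow> ('a, 'b, 'm) module_scheme \<Rightarrow> 'b \<Rightarrow> 'a set" where
  "filter_set A R x = {a \<in> carrier A.
     (\<lambda>r. x \<otimes>\<^bsub>R\<^esub> r) ` carrier R \<subseteq> (\<lambda>r. a \<odot>\<^bsub>R\<^esub> r) ` carrier R}"

text \<open>If \<open>x \<noteq> 0\<close> then \<open>0\<close> is not in its filter set, so \<open>Fin -`\<close> only strips the constructor.\<close>

definition filter_qv :: "('a, 'k) ring_scheme \<Rightarrow> ('a \<Rightarrow> 'g::linordered_ab_group_add with_top) \<Rightarrow>
    ('a, 'b, 'm) module_scheme \<Rightarrow> 'b \<Rightarrow> 'g cut with_top" where
  "filter_qv F v R x = (if x = \<zero>\<^bsub>R\<^esub> then Top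
     else Fin (cut_plus (Fin -` (v ` filter_set (valuation_ring F v) R x))))"

end

theory Submission
  imports Defs
begin

text \<open>The filter quasi-valuation makes sense on all of \<open>R \<otimes> F\<close>: for \<open>x\<close> nonzero let \<open>W x\<close> be
  the cut generated by the values of all \<open>a \<in> F\<close> with \<open>xR \<subseteq> aR\<close>, where \<open>aR = R \<otimes> a\<close>. From
  \<open>xR \<subseteq> aR\<close> and \<open>yR \<subseteq> bR\<close> one gets \<open>xyR \<subseteq> abR\<close>, and \<open>bR \<subseteq> aR\<close> if \<open>v a \<le> v b\<close>; hence \<open>W\<close> is a
  quasi-valuation. On \<open>R\<close> it agrees with \<open>w\<close> because \<open>1\<close> is then an admissible \<open>a\<close>, so that
  those \<open>a\<close> of negative value do not enlarge the cut. As \<open>1 \<in> R\<close>, \<open>W x \<ge> 0\<close> means \<open>x \<in> aR \<subseteq> R\<close> for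
  some \<open>a\<close> of nonnegative value.

  Torsion freeness enters only through the injectivity of \<open>r \<mapsto> r \<otimes> 1\<close>. Instead of building the
  module of fractions, one clears denominators: \<open>m \<otimes> n\<close> is sent to \<open>(dn) m \<in> R\<close>, and a given element
  of the kernel of the free presentation is annihilated as soon as \<open>d\<close> is sufficiently divisible.\<close>

section \<open>Homomorphisms on free abelian groups\<close>

text \<open>In the product of \<open>pair_ring\<close> the right factor sits inside the function
  given to the outer \<open>frag_extend\<close>. Distributivity over differences in that factor
  therefore needs additivity in the function argument.\<close>

lemma frag_extend_fun_diff:
  "frag_extend (\<lambda>p. f p - g p) x = frag_extend f x - frag_extend g x"
proof -
  \<comment> \<open>The trivial bound only serves as the premise that \<open>frag_induction\<close>
    consumes.\<close>
  have "Poly_Mapping.keys x \<subseteq> UNIV" by simp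
  then show ?thesis
    by (induction x rule: frag_induction) (simp_all add: frag_extend_diff algebra_simps)
qed

lemma hom_free_Abelian_group_diff:
  assumes "abelian_group G" "h \<in> hom (free_Abelian_group S) (add_monoid G)"
    and "Poly_Mapping.keys x \<subseteq> S" "Poly_Mapping.keys y \<subseteq> S"
  shows "h (x - y) = h x \<ominus>\<^bsub>G\<^esub> h y"
proof -
  interpret G: abelian_group G by fact
  interpret group_hom "free_Abelian_group S" "add_monoid G" h
    using assms(2) G.a_group by (intro group_hom.intro group_hom_axioms.intro) auto
  show ?thesis
    using hom_mult[of x "- y"] hom_inv[of y] assms(3,4)
    by (simp add: a_minus_def a_inv_def)
qed

lemma hom_free_Abelian_group_exists:
  assumes "abelian_group G" "f ` S \<subseteq> carrier G"
  shows "\<exists>h\<in>hom (free_Abelian_group S) (add_monoid G). \<forall>x\<in>S. h (frag_of x) = f x"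
proof -
  have "f ` S \<subseteq> carrier (add_monoid G)" using assms(2) by simp
  then obtain h where "h \<in> hom (free_Abelian_group S) (add_monoid G)" "\<And>x. x \<in> S \<Longrightarrow> h (frag_of x) = f x"
    using comm_group.free_Abelian_group_universal[OF abelian_group.a_comm_group[OF assms(1)]] by blast
  then show ?thesis by blast
qed

section \<open>Ring structure of the pair ring\<close>

text \<open>This makes the facts about \<open>free_Abelian_group\<close>, such as commutativity and
  the form of inverses, available for the additive group of the pair ring.\<close>

lemma add_monoid_pair_ring:
  "add_monoid (pair_ring M N) = free_Abelian_group (carrier M \<times> carrier N)"
  by (simp add: pair_ring_def free_Abelian_group_def)

lemma carrier_pair_ring: "carrier (pair_ring M N) = {c. Poly_Mapping.keys c \<subseteq> carrier M \<times> carrier N}"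
  by (simp add: pair_ring_def)

lemma zero_pair_ring [simp]: "\<zero>\<^bsub>pair_ring M N\<^esub> = 0"
  and add_pair_ring [simp]: "x \<oplus>\<^bsub>pair_ring M N\<^esub> y = x + y"
  and one_pair_ring: "\<one>\<^bsub>pair_ring M N\<^esub> = frag_of (\<one>\<^bsub>M\<^esub>, \<one>\<^bsub>N\<^esub>)"
  by (simp_all add: pair_ring_def)

lemma mult_pair_ring_frag_of [simp]:
  "frag_of (m, n) \<otimes>\<^bsub>pair_ring M N\<^esub> frag_of (m', n') = frag_of (m \<otimes>\<^bsub>M\<^esub> m', n \<otimes>\<^bsub>N\<^esub> n')"
  by (simp add: pair_ring_def)

lemma mult_pair_ring_0 [simp]:
  "0 \<otimes>\<^bsub>pair_ring M N\<^esub> y = 0" "x \<otimes>\<^bsub>pair_ring M N\<^esub> 0 = 0"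
  by (simp_all add: pair_ring_def frag_extend_eq_0 split_def)

text \<open>No membership in the carrier is required, since \<open>frag_extend\<close> is additive
  on all formal sums. Differences come before sums because they form the inductive step of
  \<open>pair_ring_induct\<close>.\<close>

lemma mult_pair_ring_diff:
  "(x - x') \<otimes>\<^bsub>pair_ring M N\<^esub> y = x \<otimes>\<^bsub>pair_ring M N\<^esub> y - x' \<otimes>\<^bsub>pair_ring M N\<^esub> y"
  "x \<otimes>\<^bsub>pair_ring M N\<^esub> (y - y') = x \<otimes>\<^bsub>pair_ring M N\<^esub> y - x \<otimes>\<^bsub>pair_ring M N\<^esub> y'"
  by (simp_all add: pair_ring_def frag_extend_diff frag_extend_fun_diff split_def)

lemma mult_pair_ring_minus:
  "(- x) \<otimes>\<^bsub>pair_ring M N\<^esub> y = - (x \<otimes>\<^bsub>pair_ring M N\<^esub> y)"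
  "x \<otimes>\<^bsub>pair_ring M N\<^esub> (- y) = - (x \<otimes>\<^bsub>pair_ring M N\<^esub> y)"
  using mult_pair_ring_diff(1)[where x = 0 and x' = x] mult_pair_ring_diff(2)[where y = 0 and y' = y] by simp_all

lemma mult_pair_ring_add:
  "(x + x') \<otimes>\<^bsub>pair_ring M N\<^esub> y = x \<otimes>\<^bsub>pair_ring M N\<^esub> y + x' \<otimes>\<^bsub>pair_ring M N\<^esub> y"
  "x \<otimes>\<^bsub>pair_ring M N\<^esub> (y + y') = x \<otimes>\<^bsub>pair_ring M N\<^esub> y + x \<otimes>\<^bsub>pair_ring M N\<^esub> y'"
  using mult_pair_ring_diff(1)[where x = x and x' = "- x'"] mult_pair_ring_diff(2)[where y = y and y' = "- y'"]
  by (simp_all add: mult_pair_ring_minus)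

lemma frag_of_in_pair_ring [simp]:
  "frag_of (m, n) \<in> carrier (pair_ring M N) \<longleftrightarrow> m \<in> carrier M \<and> n \<in> carrier N"
  by (simp add: carrier_pair_ring keys_frag_of)

lemma pair_ring_induct [consumes 1, case_names zero one diff]:
  assumes "x \<in> carrier (pair_ring M N)"
    and "P 0"
    and "\<And>m n. m \<in> carrier M \<Longrightarrow> n \<in> carrier N \<Longrightarrow> P (frag_of (m, n))"
    and "\<And>x y. P x \<Longrightarrow> P y \<Longrightarrow> P (x - y)"
  shows "P x"
proof -
  have "Poly_Mapping.keys x \<subseteq> carrier M \<times> carrier N"
    using assms(1) by (simp add: carrier_pair_ring)
  then show ?thesis
    by (induction x rule: frag_induction) (use assms in auto)
qed

lemma diff_closed_pair_ring:
  assumes "x \<in> carrier (pair_ring M N)" "y \<in> carrier (pair_ring M N)"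
  shows "x - y \<in> carrier (pair_ring M N)"
  using assms keys_diff[of x y] by (auto simp: carrier_pair_ring)

lemma minus_pair_ring:
  assumes "x \<in> carrier (pair_ring M N)" "y \<in> carrier (pair_ring M N)"
  shows "x \<ominus>\<^bsub>pair_ring M N\<^esub> y = x - y"
  using assms unfolding a_minus_def a_inv_def add_monoid_pair_ring
  by (simp add: carrier_pair_ring)

text \<open>The product is additive in each factor, so closure, the unit laws and associativity can
  be checked on generators, where they come from \<open>M\<close> and \<open>N\<close>. The
  inductions treat one argument at a time: \<open>closed1\<close> and \<open>assoc1\<close>,
  \<open>assoc2\<close> are the intermediate stages.\<close>

lemma ring_pair_ring:
  assumes "ring M" "ring N"
  shows "ring (pair_ring M N)"
proof -
  interpret M: ring M by fact
  interpret N: ring N by fact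
  let ?P = "pair_ring M N"
  have grp: "comm_group (add_monoid ?P)"
    unfolding add_monoid_pair_ring by (rule abelian_free_Abelian_group)
  then have grp': "abelian_group ?P"
    by (intro comm_group_abelian_groupI)
  have one_l: "\<one>\<^bsub>?P\<^esub> \<otimes>\<^bsub>?P\<^esub> x = x" and one_r: "x \<otimes>\<^bsub>?P\<^esub> \<one>\<^bsub>?P\<^esub> = x" if "x \<in> carrier ?P" for x
    using that
    by (induction x rule: pair_ring_induct) (auto simp: one_pair_ring mult_pair_ring_diff)
  have closed1: "frag_of (m, n) \<otimes>\<^bsub>?P\<^esub> y \<in> carrier ?P"
    if "m \<in> carrier M" "n \<in> carrier N" "y \<in> carrier ?P" for m n y
    using that(3)
  proof (induction y rule: pair_ring_induct)
    case zero show ?case by (simp add: carrier_pair_ring)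
  qed (use that in \<open>auto simp: mult_pair_ring_diff intro: diff_closed_pair_ring\<close>)
  have closed: "x \<otimes>\<^bsub>?P\<^esub> y \<in> carrier ?P" if "x \<in> carrier ?P" "y \<in> carrier ?P" for x y
    using that(1)
  proof (induction x rule: pair_ring_induct)
    case zero show ?case by (simp add: carrier_pair_ring)
  qed (use that in \<open>auto simp: mult_pair_ring_diff intro: diff_closed_pair_ring closed1\<close>)
  have assoc1: "(frag_of (m, n) \<otimes>\<^bsub>?P\<^esub> frag_of (m', n')) \<otimes>\<^bsub>?P\<^esub> z
      = frag_of (m, n) \<otimes>\<^bsub>?P\<^esub> (frag_of (m', n') \<otimes>\<^bsub>?P\<^esub> z)"
    if "m \<in> carrier M" "n \<in> carrier N" "m' \<in> carrier M" "n' \<in> carrier N" "z \<in> carrier ?P"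
    for m n m' n' z
    using that(5) that(1-4)
    by (induction z rule: pair_ring_induct)
      (auto simp: mult_pair_ring_diff M.m_assoc N.m_assoc)
  have assoc2: "(frag_of (m, n) \<otimes>\<^bsub>?P\<^esub> y) \<otimes>\<^bsub>?P\<^esub> z = frag_of (m, n) \<otimes>\<^bsub>?P\<^esub> (y \<otimes>\<^bsub>?P\<^esub> z)"
    if "m \<in> carrier M" "n \<in> carrier N" "y \<in> carrier ?P" "z \<in> carrier ?P" for m n y z
    using that(3)
    \<comment> \<open>The restriction to \<open>only\<close> keeps
      \<open>mult_pair_ring_frag_of\<close> out: it would multiply the two generators first, and
      \<open>assoc1\<close> would no longer match.\<close>
    by (induction y rule: pair_ring_induct)
      (simp_all only: mult_pair_ring_diff mult_pair_ring_0 assoc1 that)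
  have assoc: "(x \<otimes>\<^bsub>?P\<^esub> y) \<otimes>\<^bsub>?P\<^esub> z = x \<otimes>\<^bsub>?P\<^esub> (y \<otimes>\<^bsub>?P\<^esub> z)"
    if "x \<in> carrier ?P" "y \<in> carrier ?P" "z \<in> carrier ?P" for x y z
    using that(1)
    by (induction x rule: pair_ring_induct)
      (simp_all only: mult_pair_ring_diff mult_pair_ring_0 assoc2 that)
  show ?thesis
  proof (rule ringI[OF grp'])
    show "Group.monoid ?P"
      by (rule monoidI) (auto simp: closed assoc one_l one_r, simp add: one_pair_ring)
  qed (auto simp: mult_pair_ring_add)
qed

section \<open>The tensor kernel as a two-sided ideal\<close>

lemma tensor_relatorsE:
  assumes "k \<in> tensor_relators A M N"
  obtains
      (L) p p' q where "p \<in> carrier M" "p' \<in> carrier M" "q \<in> carrier N"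
        "k = frag_of (p \<oplus>\<^bsub>M\<^esub> p', q) - frag_of (p, q) - frag_of (p', q)"
    | (R) p q q' where "p \<in> carrier M" "q \<in> carrier N" "q' \<in> carrier N"
        "k = frag_of (p, q \<oplus>\<^bsub>N\<^esub> q') - frag_of (p, q) - frag_of (p, q')"
    | (S) a p q where "a \<in> carrier A" "p \<in> carrier M" "q \<in> carrier N"
        "k = frag_of (a \<odot>\<^bsub>M\<^esub> p, q) - frag_of (p, a \<odot>\<^bsub>N\<^esub> q)"
  using assms unfolding tensor_relators_def by auto

text \<open>Multiplication by a generator turns a relator into one of the same kind with multiplied
  entries. Distributivity gives this for the two additive kinds, and \<open>smult_mult_left\<close>
  and \<open>smult_mult_right\<close> give it for the balancing kind.\<close>

lemma tensor_relators_mult: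
  assumes "assoc_algebra A M" "assoc_algebra A N" "k \<in> tensor_relators A M N"
    and "m \<in> carrier M" "n \<in> carrier N"
  shows "frag_of (m, n) \<otimes>\<^bsub>pair_ring M N\<^esub> k \<in> tensor_relators A M N"
    and "k \<otimes>\<^bsub>pair_ring M N\<^esub> frag_of (m, n) \<in> tensor_relators A M N"
proof -
  interpret M: assoc_algebra A M by fact
  interpret N: assoc_algebra A N by fact
  from assms(3) show "frag_of (m, n) \<otimes>\<^bsub>pair_ring M N\<^esub> k \<in> tensor_relators A M N"
  proof (cases rule: tensor_relatorsE)
    case (L p p' q)
    then have "frag_of (m, n) \<otimes>\<^bsub>pair_ring M N\<^esub> k =
      frag_of (m \<otimes>\<^bsub>M\<^esub> p \<oplus>\<^bsub>M\<^esub> m \<otimes>\<^bsub>M\<^esub> p', n \<otimes>\<^bsub>N\<^esub> q) - frag_of (m \<otimes>\<^bsub>M\<^esub> p, n \<otimes>\<^bsub>N\<^esub> q) - frag_of (m \<otimes>\<^bsub>M\<^esub> p', n \<otimes>\<^bsub>N\<^esub> q)"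
      using assms by (simp add: mult_pair_ring_diff M.r_distr)
    with L assms show ?thesis unfolding tensor_relators_def by blast
  next
    case (R p q q')
    then have "frag_of (m, n) \<otimes>\<^bsub>pair_ring M N\<^esub> k =
      frag_of (m \<otimes>\<^bsub>M\<^esub> p, n \<otimes>\<^bsub>N\<^esub> q \<oplus>\<^bsub>N\<^esub> n \<otimes>\<^bsub>N\<^esub> q') - frag_of (m \<otimes>\<^bsub>M\<^esub> p, n \<otimes>\<^bsub>N\<^esub> q) - frag_of (m \<otimes>\<^bsub>M\<^esub> p, n \<otimes>\<^bsub>N\<^esub> q')"
      using assms by (simp add: mult_pair_ring_diff N.r_distr)
    with R assms show ?thesis unfolding tensor_relators_def by blast
  next
    case (S a p q)
    then have "frag_of (m, n) \<otimes>\<^bsub>pair_ring M N\<^esub> k =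
      frag_of (a \<odot>\<^bsub>M\<^esub> (m \<otimes>\<^bsub>M\<^esub> p), n \<otimes>\<^bsub>N\<^esub> q) - frag_of (m \<otimes>\<^bsub>M\<^esub> p, a \<odot>\<^bsub>N\<^esub> (n \<otimes>\<^bsub>N\<^esub> q))"
      using assms by (simp add: mult_pair_ring_diff M.smult_mult_right N.smult_mult_right)
    with S assms show ?thesis unfolding tensor_relators_def by blast
  qed
  from assms(3) show "k \<otimes>\<^bsub>pair_ring M N\<^esub> frag_of (m, n) \<in> tensor_relators A M N"
  proof (cases rule: tensor_relatorsE)
    case (L p p' q)
    then have "k \<otimes>\<^bsub>pair_ring M N\<^esub> frag_of (m, n) =
      frag_of (p \<otimes>\<^bsub>M\<^esub> m \<oplus>\<^bsub>M\<^esub> p' \<otimes>\<^bsub>M\<^esub> m, q \<otimes>\<^bsub>N\<^esub> n) - frag_of (p \<otimes>\<^bsub>M\<^esub> m, q \<otimes>\<^bsub>N\<^esub> n) - frag_of (p' \<otimes>\<^bsub>M\<^esub> m, q \<otimes>\<^bsub>N\<^esub> n)"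
      using assms by (simp add: mult_pair_ring_diff M.l_distr)
    with L assms show ?thesis unfolding tensor_relators_def by blast
  next
    case (R p q q')
    then have "k \<otimes>\<^bsub>pair_ring M N\<^esub> frag_of (m, n) =
      frag_of (p \<otimes>\<^bsub>M\<^esub> m, q \<otimes>\<^bsub>N\<^esub> n \<oplus>\<^bsub>N\<^esub> q' \<otimes>\<^bsub>N\<^esub> n) - frag_of (p \<otimes>\<^bsub>M\<^esub> m, q \<otimes>\<^bsub>N\<^esub> n) - frag_of (p \<otimes>\<^bsub>M\<^esub> m, q' \<otimes>\<^bsub>N\<^esub> n)"
      using assms by (simp add: mult_pair_ring_diff N.l_distr)
    with R assms show ?thesis unfolding tensor_relators_def by blast
  next
    case (S a p q)
    then have "k \<otimes>\<^bsub>pair_ring M N\<^esub> frag_of (m, n) =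
      frag_of (a \<odot>\<^bsub>M\<^esub> (p \<otimes>\<^bsub>M\<^esub> m), q \<otimes>\<^bsub>N\<^esub> n) - frag_of (p \<otimes>\<^bsub>M\<^esub> m, a \<odot>\<^bsub>N\<^esub> (q \<otimes>\<^bsub>N\<^esub> n))"
      using assms by (simp add: mult_pair_ring_diff M.smult_mult_left N.smult_mult_left)
    with S assms show ?thesis unfolding tensor_relators_def by blast
  qed
qed

lemma tensor_relators_subset:
  assumes "assoc_algebra A M" "assoc_algebra A N"
  shows "tensor_relators A M N \<subseteq> carrier (pair_ring M N)"
proof -
  interpret M: assoc_algebra A M by fact
  interpret N: assoc_algebra A N by fact
  show ?thesis
    unfolding tensor_relators_def by (auto intro!: diff_closed_pair_ring)
qed

text \<open>Absorption is additive both in the kernel element and in the ring element. It thus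
  reduces to a relator times a generator, which is \<open>tensor_relators_mult\<close>.\<close>

lemma ideal_tensor_kernel:
  assumes "assoc_algebra A M" "assoc_algebra A N"
  shows "ideal (tensor_kernel A M N) (pair_ring M N)"
proof -
  interpret M: assoc_algebra A M by fact
  interpret N: assoc_algebra A N by fact
  let ?P = "pair_ring M N" and ?K = "tensor_kernel A M N" and ?S = "tensor_relators A M N"
  interpret P: ring ?P by (rule ring_pair_ring) unfold_locales
  have sub: "?S \<subseteq> carrier ?P" by (rule tensor_relators_subset[OF assms])
  have "subgroup ?K (add_monoid ?P)"
    unfolding tensor_kernel_def
    by (rule P.add.generate_is_subgroup) (use sub in simp)
  then interpret K: subgroup ?K "add_monoid ?P" .
  have incl: "s \<in> ?K" if "s \<in> ?S" for s
    using that unfolding tensor_kernel_def by (rule generate.incl)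
  have inv_eq: "inv\<^bsub>add_monoid ?P\<^esub> x = - x" if "x \<in> carrier ?P" for x
    using that unfolding add_monoid_pair_ring by (simp add: carrier_pair_ring)
  have uminus: "- x \<in> ?K" if "x \<in> ?K" for x
  proof -
    have "x \<in> carrier ?P" using K.subset that by auto
    then show ?thesis using K.m_inv_closed[OF that] by (simp only: inv_eq)
  qed
  have plus: "x + y \<in> ?K" if "x \<in> ?K" "y \<in> ?K" for x y
    using K.m_closed[OF that] by simp
  have zero: "0 \<in> ?K" using K.one_closed by simp
  have diff: "x - y \<in> ?K" if "x \<in> ?K" "y \<in> ?K" for x y
    using plus[OF that(1) uminus[OF that(2)]] by simp
  \<comment> \<open>Induction over the generated subgroup, in additive notation. Inverses are formed
    of relators only, so closure of \<open>Q\<close> under negation covers them.\<close>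
  have ind: "Q k" if "k \<in> ?K" "Q 0" "\<And>s. s \<in> ?S \<Longrightarrow> Q s" "\<And>x. Q x \<Longrightarrow> Q (- x)"
    "\<And>x y. Q x \<Longrightarrow> Q y \<Longrightarrow> Q (x + y)" for Q k
    using that(1) unfolding tensor_kernel_def
  proof (induction k rule: generate.induct)
    case (inv h)
    then have "inv\<^bsub>add_monoid ?P\<^esub> h = - h" using sub inv_eq by blast
    with inv that show ?case by simp
  qed (use that in auto)
  have base: "frag_of (m, n) \<otimes>\<^bsub>?P\<^esub> k \<in> ?K \<and> k \<otimes>\<^bsub>?P\<^esub> frag_of (m, n) \<in> ?K"
    if "k \<in> ?K" "m \<in> carrier M" "n \<in> carrier N" for k m n
    using that(1)
  proof (rule ind)
    show "frag_of (m, n) \<otimes>\<^bsub>?P\<^esub> s \<in> ?K \<and> s \<otimes>\<^bsub>?P\<^esub> frag_of (m, n) \<in> ?K" if "s \<in> ?S" for s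
      using tensor_relators_mult[OF assms that \<open>m \<in> carrier M\<close> \<open>n \<in> carrier N\<close>] incl by blast
  qed (simp_all add: zero mult_pair_ring_minus mult_pair_ring_add uminus plus)
  have "x \<otimes>\<^bsub>?P\<^esub> k \<in> ?K \<and> k \<otimes>\<^bsub>?P\<^esub> x \<in> ?K" if "k \<in> ?K" "x \<in> carrier ?P" for k x
    using that(2)
    by (induction x rule: pair_ring_induct)
      (simp_all add: base[OF that(1)] zero mult_pair_ring_diff diff)
  then show ?thesis
    using P.ring_axioms K.subgroup_axioms by (intro idealI) blast+
qed


section \<open>Pure tensors in the quotient ring\<close>

context
  fixes A :: "('a, 'k) ring_scheme" and M :: "('a, 'b, 'm) module_scheme"
    and N :: "('a, 'c, 'n) module_scheme"
  assumes algebras: "assoc_algebra A M" "assoc_algebra A N"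
begin

interpretation M: assoc_algebra A M by (rule algebras)
interpretation N: assoc_algebra A N by (rule algebras)
interpretation K: ideal "tensor_kernel A M N" "pair_ring M N"
  by (rule ideal_tensor_kernel[OF algebras])

lemma ring_tensor_algebra: "ring (tensor_algebra A M N)"
  unfolding tensor_algebra_def by (rule K.quotient_is_ring)

text \<open>The right-hand side is the coset of an arbitrary \<open>x\<close>, because additivity
  compares a pure tensor with the coset of a sum of two generators.\<close>

lemma pure_tensor_eqI:
  assumes "m \<in> carrier M" "n \<in> carrier N" "x \<in> carrier (pair_ring M N)"
    and "frag_of (m, n) - x \<in> tensor_kernel A M N"
  shows "pure_tensor A M N m n = tensor_kernel A M N +>\<^bsub>pair_ring M N\<^esub> x"
  unfolding pure_tensor_def
  using K.quotient_eq_iff_same_a_r_cos[OF K.ideal_axioms, of "frag_of (m, n)" x] assms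
  by (simp add: minus_pair_ring)

lemma pure_tensor_eqD:
  assumes "m \<in> carrier M" "n \<in> carrier N" "m' \<in> carrier M" "n' \<in> carrier N"
    and "pure_tensor A M N m n = pure_tensor A M N m' n'"
  shows "frag_of (m, n) - frag_of (m', n') \<in> tensor_kernel A M N"
  using K.quotient_eq_iff_same_a_r_cos[OF K.ideal_axioms, of "frag_of (m, n)" "frag_of (m', n')"] assms
  by (simp add: minus_pair_ring pure_tensor_def)

lemma pure_tensor_closed:
  assumes "m \<in> carrier M" "n \<in> carrier N"
  shows "pure_tensor A M N m n \<in> carrier (tensor_algebra A M N)"
  unfolding pure_tensor_def tensor_algebra_def
  using ring_hom_closed[OF K.rcos_ring_hom] assms by simp

lemma pure_tensor_mult:
  assumes "m \<in> carrier M" "n \<in> carrier N" "m' \<in> carrier M" "n' \<in> carrier N"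
  shows "pure_tensor A M N m n \<otimes>\<^bsub>tensor_algebra A M N\<^esub> pure_tensor A M N m' n'
    = pure_tensor A M N (m \<otimes>\<^bsub>M\<^esub> m') (n \<otimes>\<^bsub>N\<^esub> n')"
  unfolding pure_tensor_def tensor_algebra_def
  using ring_hom_mult[OF K.rcos_ring_hom, of "frag_of (m, n)" "frag_of (m', n')"] assms by simp

lemma pure_tensor_one: "pure_tensor A M N \<one>\<^bsub>M\<^esub> \<one>\<^bsub>N\<^esub> = \<one>\<^bsub>tensor_algebra A M N\<^esub>"
  unfolding pure_tensor_def tensor_algebra_def
  using ring_hom_one[OF K.rcos_ring_hom] by (simp add: one_pair_ring)

lemma pure_tensor_add_left:
  assumes "m \<in> carrier M" "m' \<in> carrier M" "n \<in> carrier N"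
  shows "pure_tensor A M N (m \<oplus>\<^bsub>M\<^esub> m') n
    = pure_tensor A M N m n \<oplus>\<^bsub>tensor_algebra A M N\<^esub> pure_tensor A M N m' n"
proof -
  have "frag_of (m \<oplus>\<^bsub>M\<^esub> m', n) - frag_of (m, n) - frag_of (m', n) \<in> tensor_kernel A M N"
    unfolding tensor_kernel_def tensor_relators_def using assms by (intro generate.incl) blast
  then have "frag_of (m \<oplus>\<^bsub>M\<^esub> m', n) - (frag_of (m, n) + frag_of (m', n)) \<in> tensor_kernel A M N"
    by (simp only: diff_diff_add)
  moreover have "frag_of (m, n) + frag_of (m', n) \<in> carrier (pair_ring M N)"
    using K.a_closed[of "frag_of (m, n)" "frag_of (m', n)"] assms by simp
  ultimately have "pure_tensor A M N (m \<oplus>\<^bsub>M\<^esub> m') n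
      = tensor_kernel A M N +>\<^bsub>pair_ring M N\<^esub> (frag_of (m, n) + frag_of (m', n))"
    using assms by (intro pure_tensor_eqI) auto
  then show ?thesis
    unfolding pure_tensor_def tensor_algebra_def
    using ring_hom_add[OF K.rcos_ring_hom, of "frag_of (m, n)" "frag_of (m', n)"] assms by simp
qed

lemma pure_tensor_smult:
  assumes "a \<in> carrier A" "m \<in> carrier M" "n \<in> carrier N"
  shows "pure_tensor A M N (a \<odot>\<^bsub>M\<^esub> m) n = pure_tensor A M N m (a \<odot>\<^bsub>N\<^esub> n)"
proof -
  have "frag_of (a \<odot>\<^bsub>M\<^esub> m, n) - frag_of (m, a \<odot>\<^bsub>N\<^esub> n) \<in> tensor_kernel A M N"
    unfolding tensor_kernel_def tensor_relators_def using assms by (intro generate.incl) blast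
  then show ?thesis
    unfolding pure_tensor_def[of A M N m] using assms by (intro pure_tensor_eqI) auto
qed

end

section \<open>The field as an algebra over its subrings\<close>

lemma self_module_simps [simp]:
  "carrier (self_module F) = carrier F"
  "monoid.mult (self_module F) = monoid.mult F"
  "one (self_module F) = one F"
  "ring.zero (self_module F) = ring.zero F"
  "add (self_module F) = add F"
  "smult (self_module F) = monoid.mult F"
  by (simp_all add: self_module_def)

text \<open>The valuation ring is a record update of this form, so \<open>F\<close> becomes an
  algebra over it and can serve as a tensor factor.\<close>

lemma assoc_algebra_self_module:
  assumes "cring F" "cring (F\<lparr>carrier := H\<rparr>)" "H \<subseteq> carrier F"
  shows "assoc_algebra (F\<lparr>carrier := H\<rparr>) (self_module F)"
proof -
  interpret F: cring F by fact
  have H: "x \<in> carrier F" if "x \<in> H" for x using assms(3) that by blast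
  have "abelian_group (self_module F)"
    by (rule abelian_groupI) (auto simp: F.a_ac intro: F.l_neg)
  moreover have "ring (self_module F)"
    by (rule ringI) (auto intro: calculation monoidI simp: F.m_assoc F.l_distr F.r_distr)
  ultimately show ?thesis
    using assms(2) H
    by (intro assoc_algebra.intro module.intro module_axioms.intro assoc_algebra_axioms.intro)
      (auto simp: F.m_ac F.l_distr F.r_distr H)
qed

section \<open>Cuts of values and elementary valuation theory\<close>

lemma with_top_simps [simp]:
  "Fin a \<le> Fin b \<longleftrightarrow> a \<le> b" "x \<le> Top" "Top \<le> Fin a \<longleftrightarrow> False"
  "Fin c + Fin d = Fin (c + d)" "Top + y = Top" "y + Top = Top"
  by (auto simp: less_eq_with_top_def plus_with_top_def split: with_top.splits)

text \<open>The working description of the cuts that occur: elements of value \<open>Top\<close>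
  drop out, and comparing two cuts becomes a search for an element of sufficiently large
  value.\<close>

lemma mem_cut_plus_vimage_Fin:
  "\<alpha> \<in> cut_left (cut_plus (Fin -` (v ` S))) \<longleftrightarrow> (\<exists>a\<in>S. \<exists>\<gamma>. v a = Fin \<gamma> \<and> \<alpha> \<le> \<gamma>)"
  unfolding cut_left_cut_plus by force

lemma valuation_ring_simps [simp]:
  "x \<in> carrier (valuation_ring F v) \<longleftrightarrow> x \<in> carrier F \<and> 0 \<le> v x"
  "monoid.mult (valuation_ring F v) = monoid.mult F"
  "one (valuation_ring F v) = one F"
  "ring.zero (valuation_ring F v) = ring.zero F"
  "add (valuation_ring F v) = add F"
  by (simp_all add: valuation_ring_def)

context valuation
begin

lemma val_zero [simp]: "v \<zero> = Top"
  by (simp add: val_eq_Top_iff)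

lemma val_one [simp]: "v \<one> = 0"
proof -
  obtain g where g: "v \<one> = Fin g"
    using val_eq_Top_iff[of \<one>] by (cases "v \<one>") auto
  \<comment> \<open>Since \<open>\<one>\<close> is its own square, \<open>g = g + g\<close> in the
    value group, so \<open>g = 0\<close>.\<close>
  then show ?thesis
    using val_mult[of \<one> \<one>] by (simp add: zero_with_top_def)
qed

text \<open>The value of \<open>b\<close> is that of the quotient plus \<open>v a\<close>, and
  \<open>v a\<close> can be cancelled because it is finite.\<close>

lemma val_divide_nonneg:
  assumes "a \<in> carrier F" "b \<in> carrier F" "a \<noteq> \<zero>" "v a \<le> v b"
  shows "b \<otimes> inv a \<in> carrier F" "0 \<le> v (b \<otimes> inv a)" "(b \<otimes> inv a) \<otimes> a = b"
proof -
  show closed: "b \<otimes> inv a \<in> carrier F" and eq: "(b \<otimes> inv a) \<otimes> a = b"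
    using assms by (simp_all add: field_Units m_assoc)
  obtain g where g: "v a = Fin g"
    using val_eq_Top_iff[of a] assms by (cases "v a") auto
  have "v b = v (b \<otimes> inv a) + v a"
    using val_mult[OF closed assms(1)] eq by simp
  then show "0 \<le> v (b \<otimes> inv a)"
    using assms(4) g by (cases "v (b \<otimes> inv a)") (auto simp: zero_with_top_def)
qed

text \<open>If \<open>n\<close> has nonnegative value, \<open>\<one>\<close> will do. Otherwise
  \<open>inv n\<close> has nonnegative value by \<open>val_divide_nonneg\<close>, and multiplying it
  by \<open>n\<close> gives \<open>\<one>\<close>.\<close>

lemma common_denominator:
  assumes "n \<in> carrier F"
  obtains d where "d \<in> carrier F" "0 \<le> v d" "d \<noteq> \<zero>" "0 \<le> v (d \<otimes> n)"
proof (cases "0 \<le> v n")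
  case True
  then show thesis using that[of \<one>] assms by simp
next
  case False
  with assms have n: "n \<noteq> \<zero>" by auto
  with assms False val_divide_nonneg[of n \<one>] have "0 \<le> v (inv n)"
    by (simp add: field_Units)
  moreover have "inv n \<noteq> \<zero>"
  proof
    assume "inv n = \<zero>"
    moreover have "inv n \<otimes> n = \<one>" using assms n by (simp add: field_Units)
    ultimately show False using assms by simp
  qed
  ultimately show thesis
    using that[of "inv n"] assms n by (simp add: field_Units)
qed

end


section \<open>Injectivity of the map from \<open>R\<close> into the tensor product\<close>

locale torsion_free_valuation_algebra =
  valuation F v + R: assoc_algebra "valuation_ring F v" R
  for F :: "('f, 'k) ring_scheme" (structure)
    and v :: "'f \<Rightarrow> 'g::linordered_ab_group_add with_top"
    and R :: "('f, 'r, 'm) module_scheme" (structure) +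
  assumes torsion_free: "torsion_free (valuation_ring F v) R"
begin

abbreviation "T \<equiv> tensor_algebra (valuation_ring F v) R (self_module F)"
abbreviation "t \<equiv> pure_tensor (valuation_ring F v) R (self_module F)"

lemma smult_cancel:
  assumes "a \<in> carrier F" "0 \<le> v a" "a \<noteq> \<zero>" "r \<in> carrier R" "s \<in> carrier R"
    and "a \<odot>\<^bsub>R\<^esub> r = a \<odot>\<^bsub>R\<^esub> s"
  shows "r = s"
proof -
  have "a \<odot>\<^bsub>R\<^esub> (r \<ominus>\<^bsub>R\<^esub> s) = \<zero>\<^bsub>R\<^esub>"
    using assms R.smult_r_minus[of a s]
    by (simp add: R.minus_eq R.smult_r_distr R.r_neg)
  moreover have "a \<in> carrier (valuation_ring F v)" "r \<ominus>\<^bsub>R\<^esub> s \<in> carrier R"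
    using assms by auto
  ultimately have "r \<ominus>\<^bsub>R\<^esub> s = \<zero>\<^bsub>R\<^esub>"
    using torsion_free[unfolded torsion_free_def, rule_format, of a "r \<ominus>\<^bsub>R\<^esub> s"] assms(3)
    by simp
  with assms(4,5) show ?thesis using R.r_right_minus_eq by blast
qed

lemma assoc_algebra_field: "assoc_algebra (valuation_ring F v) (self_module F)"
  using assoc_algebra_self_module[of F "{x \<in> carrier F. 0 \<le> v x}"]
    R.R.cring_axioms is_cring by (auto simp: valuation_ring_def)

lemmas algebras = R.assoc_algebra_axioms assoc_algebra_field

text \<open>This and \<open>nonneg_add\<close> are read off from the closure of the valuation ring,
  which is a ring because \<open>R\<close> is a module over it.\<close>

lemma nonneg_mult:
  "\<lbrakk>a \<in> carrier F; b \<in> carrier F; 0 \<le> v a; 0 \<le> v b\<rbrakk> \<Longrightarrow> 0 \<le> v (a \<otimes> b)"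
  using R.R.m_closed[of a b] by simp

lemma nonneg_add:
  "\<lbrakk>a \<in> carrier F; b \<in> carrier F; 0 \<le> v a; 0 \<le> v b\<rbrakk> \<Longrightarrow> 0 \<le> v (a \<oplus> b)"
  using R.R.a_closed[of a b] by simp

text \<open>Here \<open>ev d\<close> is an additive map that sends \<open>(m, n)\<close> to
  \<open>(d n) m\<close>, prescribed only where \<open>d n\<close> lies in the valuation ring. Once
  \<open>d\<close> clears every entry from \<open>F\<close>, the module axioms send the relator to
  zero. The factor \<open>e\<close> records that integral multiples of \<open>d\<close> work too, so
  that different denominators can later be combined.\<close>

lemma relator_eval:
  assumes hom: "\<And>d. d \<in> carrier F \<Longrightarrow>
      ev d \<in> hom (free_Abelian_group (carrier R \<times> carrier F)) (add_monoid R)"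
    and ev: "\<And>d m n. d \<in> carrier F \<Longrightarrow> m \<in> carrier R \<Longrightarrow> n \<in> carrier F \<Longrightarrow>
      0 \<le> v (d \<otimes> n) \<Longrightarrow> ev d (frag_of (m, n)) = (d \<otimes> n) \<odot>\<^bsub>R\<^esub> m"
    and k: "k \<in> tensor_relators (valuation_ring F v) R (self_module F)"
  shows "\<exists>d. d \<in> carrier F \<and> 0 \<le> v d \<and> d \<noteq> \<zero> \<and>
    (\<forall>e\<in>carrier F. 0 \<le> v e \<longrightarrow> ev (d \<otimes> e) k = \<zero>\<^bsub>R\<^esub>)"
proof -
  have diff: "ev d (x - y) = ev d x \<ominus>\<^bsub>R\<^esub> ev d y"
    if "d \<in> carrier F" "Poly_Mapping.keys x \<subseteq> carrier R \<times> carrier F"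
      "Poly_Mapping.keys y \<subseteq> carrier R \<times> carrier F" for d x y
    using hom_free_Abelian_group_diff[OF R.abelian_group_axioms hom] that by blast
  \<comment> \<open>Integral multiples of a denominator are again denominators.\<close>
  have scale: "0 \<le> v ((d \<otimes> e) \<otimes> n)"
    if "d \<in> carrier F" "e \<in> carrier F" "n \<in> carrier F" "0 \<le> v e" "0 \<le> v (d \<otimes> n)" for d e n
    using nonneg_mult[of e "d \<otimes> n"] that by (simp add: m_ac)
  from k show ?thesis
  proof (cases rule: tensor_relatorsE)
    case (L p p' q)
    note L = L[unfolded self_module_simps]
    obtain d where d: "d \<in> carrier F" "0 \<le> v d" "d \<noteq> \<zero>" "0 \<le> v (d \<otimes> q)"
      using common_denominator[OF L(3)] .
    have "ev (d \<otimes> e) k = \<zero>\<^bsub>R\<^esub>" if e: "e \<in> carrier F" "0 \<le> v e" for e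
    proof -
      define c where "c = (d \<otimes> e) \<otimes> q"
      have c: "c \<in> carrier F" "0 \<le> v c" unfolding c_def using scale d e L by auto
      then have cl: "c \<odot>\<^bsub>R\<^esub> p \<in> carrier R" "c \<odot>\<^bsub>R\<^esub> p' \<in> carrier R" using L by auto
      have keys: "Poly_Mapping.keys (frag_of (p \<oplus>\<^bsub>R\<^esub> p', q) - frag_of (p, q)) \<subseteq> carrier R \<times> carrier F"
        using L by (intro order_trans[OF keys_diff]) (auto simp: keys_frag_of)
      have "ev (d \<otimes> e) k = (c \<odot>\<^bsub>R\<^esub> (p \<oplus>\<^bsub>R\<^esub> p') \<ominus>\<^bsub>R\<^esub> c \<odot>\<^bsub>R\<^esub> p) \<ominus>\<^bsub>R\<^esub> c \<odot>\<^bsub>R\<^esub> p'"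
        using L d e c keys unfolding c_def by (simp add: diff keys_frag_of ev)
      also have "\<dots> = \<zero>\<^bsub>R\<^esub>"
        using c L cl by (simp add: R.smult_r_distr R.minus_eq R.a_ac R.r_neg R.r_neg1 R.r_neg2)
      finally show ?thesis .
    qed
    with d show ?thesis by blast
  next
    case (R p q q')
    note R = R[unfolded self_module_simps]
    obtain d1 where d1: "d1 \<in> carrier F" "0 \<le> v d1" "d1 \<noteq> \<zero>" "0 \<le> v (d1 \<otimes> q)"
      using common_denominator[OF R(2)] .
    obtain d2 where d2: "d2 \<in> carrier F" "0 \<le> v d2" "d2 \<noteq> \<zero>" "0 \<le> v (d2 \<otimes> q')"
      using common_denominator[OF R(3)] .
    \<comment> \<open>The product clears both \<open>q\<close> and \<open>q'\<close>, and with them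
      their sum.\<close>
    define d where "d = d1 \<otimes> d2"
    have d: "d \<in> carrier F" "0 \<le> v d" "d \<noteq> \<zero>"
      unfolding d_def using d1 d2 nonneg_mult by (auto simp: integral_iff)
    have dq: "0 \<le> v (d \<otimes> q)" "0 \<le> v (d \<otimes> q')"
      using scale[of d1 d2 q] scale[of d2 d1 q'] d1 d2 R unfolding d_def by (auto simp: m_comm)
    have "ev (d \<otimes> e) k = \<zero>\<^bsub>R\<^esub>" if e: "e \<in> carrier F" "0 \<le> v e" for e
    proof -
      define c c' where "c = (d \<otimes> e) \<otimes> q" and "c' = (d \<otimes> e) \<otimes> q'"
      have c: "c \<in> carrier F" "0 \<le> v c" "c' \<in> carrier F" "0 \<le> v c'"
        unfolding c_def c'_def using scale d dq e R by auto
      then have cl: "c \<odot>\<^bsub>R\<^esub> p \<in> carrier R" "c' \<odot>\<^bsub>R\<^esub> p \<in> carrier R" using R by auto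
      have cc': "(d \<otimes> e) \<otimes> (q \<oplus> q') = c \<oplus> c'"
        unfolding c_def c'_def using d e R by (simp add: r_distr)
      have keys: "Poly_Mapping.keys (frag_of (p, q \<oplus> q') - frag_of (p, q)) \<subseteq> carrier R \<times> carrier F"
        using R by (intro order_trans[OF keys_diff]) (auto simp: keys_frag_of)
      have "ev (d \<otimes> e) (frag_of (p, q \<oplus> q')) = (c \<oplus> c') \<odot>\<^bsub>R\<^esub> p"
        using R d e c nonneg_add[of c c'] by (subst ev) (simp_all add: cc')
      then have "ev (d \<otimes> e) k = ((c \<oplus> c') \<odot>\<^bsub>R\<^esub> p \<ominus>\<^bsub>R\<^esub> c \<odot>\<^bsub>R\<^esub> p) \<ominus>\<^bsub>R\<^esub> c' \<odot>\<^bsub>R\<^esub> p"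
        using R d e c keys unfolding c_def c'_def by (simp add: diff keys_frag_of ev)
      also have "\<dots> = \<zero>\<^bsub>R\<^esub>"
        using c R cl R.smult_l_distr[of c c' p]
        by (simp add: R.minus_eq R.a_ac R.r_neg R.r_neg1 R.r_neg2)
      finally show ?thesis .
    qed
    with d show ?thesis by blast
  next
    case (S a p q)
    then have S: "a \<in> carrier F" "0 \<le> v a" "p \<in> carrier R" "q \<in> carrier F"
      "k = frag_of (a \<odot>\<^bsub>R\<^esub> p, q) - frag_of (p, a \<otimes> q)"
      by simp_all
    \<comment> \<open>A denominator of \<open>q\<close> is also one of \<open>a \<otimes> q\<close>,
      because \<open>v a\<close> is nonnegative.\<close>
    obtain d where d: "d \<in> carrier F" "0 \<le> v d" "d \<noteq> \<zero>" "0 \<le> v (d \<otimes> q)"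
      using common_denominator[OF S(4)] .
    have "ev (d \<otimes> e) k = \<zero>\<^bsub>R\<^esub>" if e: "e \<in> carrier F" "0 \<le> v e" for e
    proof -
      define c where "c = (d \<otimes> e) \<otimes> q"
      have c: "c \<in> carrier F" "0 \<le> v c" unfolding c_def using scale d e S by auto
      have ca: "(d \<otimes> e) \<otimes> (a \<otimes> q) = c \<otimes> a"
        unfolding c_def using d e S by (simp add: m_ac)
      have ap: "a \<odot>\<^bsub>R\<^esub> p \<in> carrier R" "c \<odot>\<^bsub>R\<^esub> (a \<odot>\<^bsub>R\<^esub> p) \<in> carrier R"
        using S c by auto
      have "ev (d \<otimes> e) (frag_of (p, a \<otimes> q)) = (c \<otimes> a) \<odot>\<^bsub>R\<^esub> p"
        using S d e c nonneg_mult[of c a] by (subst ev) (simp_all add: ca)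
      also have "\<dots> = c \<odot>\<^bsub>R\<^esub> (a \<odot>\<^bsub>R\<^esub> p)"
        using S c R.smult_assoc1[of c a p] by simp
      finally show ?thesis
        using S d e c ap unfolding c_def by (simp add: diff keys_frag_of ev)
    qed
    with d show ?thesis by blast
  qed
qed

text \<open>Relators are settled by \<open>relator_eval\<close>. For a sum, the product of the two
  denominators is an integral multiple of each, so the hypotheses for both summands apply to
  it.\<close>

lemma tensor_kernel_eval:
  assumes hom: "\<And>d. d \<in> carrier F \<Longrightarrow>
      ev d \<in> hom (free_Abelian_group (carrier R \<times> carrier F)) (add_monoid R)"
    and ev: "\<And>d m n. d \<in> carrier F \<Longrightarrow> m \<in> carrier R \<Longrightarrow> n \<in> carrier F \<Longrightarrow>
      0 \<le> v (d \<otimes> n) \<Longrightarrow> ev d (frag_of (m, n)) = (d \<otimes> n) \<odot>\<^bsub>R\<^esub> m"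
    and k: "k \<in> tensor_kernel (valuation_ring F v) R (self_module F)"
  shows "\<exists>d. d \<in> carrier F \<and> 0 \<le> v d \<and> d \<noteq> \<zero> \<and>
    (\<forall>e\<in>carrier F. 0 \<le> v e \<longrightarrow> ev (d \<otimes> e) k = \<zero>\<^bsub>R\<^esub>)"
proof -
  let ?G = "free_Abelian_group (carrier R \<times> carrier F)"
  let ?S = "tensor_relators (valuation_ring F v) R (self_module F)"
  interpret G: group ?G by simp
  have sub: "?S \<subseteq> carrier ?G"
    using tensor_relators_subset[OF algebras] by (auto simp: carrier_pair_ring)
  have gh: "group_hom ?G (add_monoid R) (ev d)" if "d \<in> carrier F" for d
    using hom[OF that] R.a_group by (intro group_hom.intro group_hom_axioms.intro) auto
  have base: "\<exists>d. d \<in> carrier F \<and> 0 \<le> v d \<and> d \<noteq> \<zero> \<and>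
      (\<forall>e\<in>carrier F. 0 \<le> v e \<longrightarrow> ev (d \<otimes> e) k = \<zero>\<^bsub>R\<^esub>)" if "k \<in> ?S" for k
    using that by (intro relator_eval[where ev = ev] hom ev)
  have "k \<in> generate ?G ?S"
    using k by (simp only: tensor_kernel_def add_monoid_pair_ring self_module_simps)
  then show ?thesis
  proof (induction k rule: generate.induct)
    case one
    have "ev (\<one> \<otimes> e) \<one>\<^bsub>?G\<^esub> = \<zero>\<^bsub>R\<^esub>" if "e \<in> carrier F" for e
      using group_hom.hom_one[OF gh, of e] that by simp
    then show ?case by (intro exI[of _ \<one>]) auto
  next
    case (incl k)
    then show ?case by (rule base)
  next
    case (inv k)
    then obtain d where d: "d \<in> carrier F" "0 \<le> v d" "d \<noteq> \<zero>"
      "\<And>e. e \<in> carrier F \<Longrightarrow> 0 \<le> v e \<Longrightarrow> ev (d \<otimes> e) k = \<zero>\<^bsub>R\<^esub>"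
      using base[of k] by blast
    have "ev (d \<otimes> e) (inv\<^bsub>?G\<^esub> k) = \<zero>\<^bsub>R\<^esub>" if "e \<in> carrier F" "0 \<le> v e" for e
      using group_hom.hom_inv[OF gh, of "d \<otimes> e" k] d that inv sub R.minus_zero
      by (auto simp: a_inv_def)
    with d show ?case by blast
  next
    case (eng x y)
    obtain c where c: "c \<in> carrier F" "0 \<le> v c" "c \<noteq> \<zero>"
      "\<And>e. e \<in> carrier F \<Longrightarrow> 0 \<le> v e \<Longrightarrow> ev (c \<otimes> e) x = \<zero>\<^bsub>R\<^esub>"
      using eng.IH(1) by blast
    obtain d where d: "d \<in> carrier F" "0 \<le> v d" "d \<noteq> \<zero>"
      "\<And>e. e \<in> carrier F \<Longrightarrow> 0 \<le> v e \<Longrightarrow> ev (d \<otimes> e) y = \<zero>\<^bsub>R\<^esub>"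
      using eng.IH(2) by blast
    have carr: "x \<in> carrier ?G" "y \<in> carrier ?G"
      using eng.hyps G.generate_in_carrier[OF sub] by blast+
    have "ev (c \<otimes> d \<otimes> e) (x \<otimes>\<^bsub>?G\<^esub> y) = \<zero>\<^bsub>R\<^esub>" if e: "e \<in> carrier F" "0 \<le> v e" for e
    proof -
      have "ev (c \<otimes> d \<otimes> e) x = \<zero>\<^bsub>R\<^esub>"
        using c(4)[of "d \<otimes> e"] c d e nonneg_mult by (simp add: m_assoc)
      moreover have "ev (c \<otimes> d \<otimes> e) y = \<zero>\<^bsub>R\<^esub>"
        using d(4)[of "c \<otimes> e"] c d e nonneg_mult by (simp add: m_ac)
      ultimately show ?thesis
        using group_hom.hom_mult[OF gh carr, of "c \<otimes> d \<otimes> e"] c d e by simp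
    qed
    with c d nonneg_mult show ?case
      by (intro exI[of _ "c \<otimes> d"]) (auto simp: integral_iff)
  qed
qed

text \<open>The difference of the two generators lies in the kernel, hence some nonzero integral
  \<open>d\<close> gives \<open>d r = d s\<close> in \<open>R\<close>. Torsion freeness cancels
  \<open>d\<close>.\<close>

lemma pure_tensor_inject:
  assumes "r \<in> carrier R" "s \<in> carrier R" "t r \<one> = t s \<one>"
  shows "r = s"
proof -
  let ?G = "free_Abelian_group (carrier R \<times> carrier F)"
  have "\<exists>h. h \<in> hom ?G (add_monoid R) \<and>
    (\<forall>m\<in>carrier R. \<forall>n\<in>carrier F. 0 \<le> v (d \<otimes> n) \<longrightarrow> h (frag_of (m, n)) = (d \<otimes> n) \<odot>\<^bsub>R\<^esub> m)"
    if "d \<in> carrier F" for d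
  proof -
    \<comment> \<open>The value zero is a mere default that makes the map total: the properties
      recorded for \<open>h\<close> concern only pairs with \<open>d \<otimes> n\<close>
      integral.\<close>
    let ?f = "\<lambda>(m, n). if 0 \<le> v (d \<otimes> n) then (d \<otimes> n) \<odot>\<^bsub>R\<^esub> m else \<zero>\<^bsub>R\<^esub>"
    have "?f ` (carrier R \<times> carrier F) \<subseteq> carrier R"
      using that by auto
    from hom_free_Abelian_group_exists[OF R.abelian_group_axioms this]
    obtain h where h: "h \<in> hom ?G (add_monoid R)"
      and f: "\<forall>x\<in>carrier R \<times> carrier F. h (frag_of x) = ?f x"
      by (elim bexE)
    have "h (frag_of (m, n)) = (d \<otimes> n) \<odot>\<^bsub>R\<^esub> m"
      if "m \<in> carrier R" "n \<in> carrier F" "0 \<le> v (d \<otimes> n)" for m n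
      using bspec[OF f, of "(m, n)"] that by simp
    with h show ?thesis by blast
  qed
  then have "\<forall>d\<in>carrier F. \<exists>h. h \<in> hom ?G (add_monoid R) \<and>
    (\<forall>m\<in>carrier R. \<forall>n\<in>carrier F. 0 \<le> v (d \<otimes> n) \<longrightarrow> h (frag_of (m, n)) = (d \<otimes> n) \<odot>\<^bsub>R\<^esub> m)"
    by (rule ballI)
  from bchoice[OF this] obtain ev where hom_ev: "\<forall>d\<in>carrier F. ev d \<in> hom ?G (add_monoid R) \<and>
    (\<forall>m\<in>carrier R. \<forall>n\<in>carrier F. 0 \<le> v (d \<otimes> n) \<longrightarrow> ev d (frag_of (m, n)) = (d \<otimes> n) \<odot>\<^bsub>R\<^esub> m)"
    by (rule exE)
  have hom: "ev d \<in> hom ?G (add_monoid R)" if "d \<in> carrier F" for d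
    using bspec[OF hom_ev that] by (rule conjunct1)
  have ev: "ev d (frag_of (m, n)) = (d \<otimes> n) \<odot>\<^bsub>R\<^esub> m"
    if "d \<in> carrier F" "m \<in> carrier R" "n \<in> carrier F" "0 \<le> v (d \<otimes> n)" for d m n
    using bspec[OF hom_ev that(1)] that(2-4) by simp
  have "frag_of (r, \<one>) - frag_of (s, \<one>) \<in> tensor_kernel (valuation_ring F v) R (self_module F)"
    using pure_tensor_eqD[OF algebras _ _ _ _ assms(3)] assms by simp
  then have "\<exists>d. d \<in> carrier F \<and> 0 \<le> v d \<and> d \<noteq> \<zero> \<and> (\<forall>e\<in>carrier F. 0 \<le> v e \<longrightarrow>
      ev (d \<otimes> e) (frag_of (r, \<one>) - frag_of (s, \<one>)) = \<zero>\<^bsub>R\<^esub>)"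
    by (intro tensor_kernel_eval[where ev = ev] hom ev)
  then obtain d where d: "d \<in> carrier F" "0 \<le> v d" "d \<noteq> \<zero>"
    and zero: "\<forall>e\<in>carrier F. 0 \<le> v e \<longrightarrow>
      ev (d \<otimes> e) (frag_of (r, \<one>) - frag_of (s, \<one>)) = \<zero>\<^bsub>R\<^esub>"
    by (elim exE conjE)
  \<comment> \<open>The instance \<open>e = \<one>\<close> suffices here. Both second entries are
    \<open>\<one>\<close>, so \<open>d\<close> itself is the scalar that acts.\<close>
  have "ev d (frag_of (r, \<one>) - frag_of (s, \<one>)) = \<zero>\<^bsub>R\<^esub>"
    using bspec[OF zero one_closed] d by simp
  then have "ev d (frag_of (r, \<one>)) \<ominus>\<^bsub>R\<^esub> ev d (frag_of (s, \<one>)) = \<zero>\<^bsub>R\<^esub>"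
    using hom_free_Abelian_group_diff[OF R.abelian_group_axioms hom[OF d(1)],
        of "frag_of (r, \<one>)" "frag_of (s, \<one>)"] d assms by (simp add: keys_frag_of)
  then have "d \<odot>\<^bsub>R\<^esub> r \<ominus>\<^bsub>R\<^esub> d \<odot>\<^bsub>R\<^esub> s = \<zero>\<^bsub>R\<^esub>"
    using d assms by (simp add: ev)
  moreover have "d \<odot>\<^bsub>R\<^esub> r \<in> carrier R" "d \<odot>\<^bsub>R\<^esub> s \<in> carrier R"
    using d assms by auto
  ultimately have "d \<odot>\<^bsub>R\<^esub> r = d \<odot>\<^bsub>R\<^esub> s"
    by (simp only: R.r_right_minus_eq)
  then show ?thesis by (rule smult_cancel[OF d assms(1,2)])
qed

section \<open>Computation with pure tensors over the field\<close>

lemma t_closed [simp]: "r \<in> carrier R \<Longrightarrow> a \<in> carrier F \<Longrightarrow> t r a \<in> carrier T"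
  using pure_tensor_closed[OF algebras] by simp

lemma t_mult:
  "\<lbrakk>r \<in> carrier R; a \<in> carrier F; s \<in> carrier R; b \<in> carrier F\<rbrakk>
    \<Longrightarrow> t r a \<otimes>\<^bsub>T\<^esub> t s b = t (r \<otimes>\<^bsub>R\<^esub> s) (a \<otimes> b)"
  using pure_tensor_mult[OF algebras] by simp

lemma t_add:
  "\<lbrakk>r \<in> carrier R; s \<in> carrier R; a \<in> carrier F\<rbrakk>
    \<Longrightarrow> t (r \<oplus>\<^bsub>R\<^esub> s) a = t r a \<oplus>\<^bsub>T\<^esub> t s a"
  using pure_tensor_add_left[OF algebras] by simp

lemma t_smult:
  "\<lbrakk>a \<in> carrier F; 0 \<le> v a; r \<in> carrier R; b \<in> carrier F\<rbrakk>
    \<Longrightarrow> t (a \<odot>\<^bsub>R\<^esub> r) b = t r (a \<otimes> b)"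
  using pure_tensor_smult[OF algebras, of a r b] by simp

lemma t_one: "t \<one>\<^bsub>R\<^esub> \<one> = \<one>\<^bsub>T\<^esub>"
  using pure_tensor_one[OF algebras] by simp

sublocale T: ring T
  by (rule ring_tensor_algebra[OF algebras])

lemma t_zero: "a \<in> carrier F \<Longrightarrow> t \<zero>\<^bsub>R\<^esub> a = \<zero>\<^bsub>T\<^esub>"
  using t_add[of "\<zero>\<^bsub>R\<^esub>" "\<zero>\<^bsub>R\<^esub>" a] T.add.r_cancel_one'[of "t \<zero>\<^bsub>R\<^esub> a" "t \<zero>\<^bsub>R\<^esub> a"] by simp

text \<open>The \<open>a\<close> with \<open>xR \<subseteq> aR\<close>, where \<open>R\<close> acts through \<open>t s \<one>\<close> and \<open>a u\<close> is written \<open>t u a\<close>.\<close>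

definition divisors :: "('r \<times> 'f \<Rightarrow>\<^sub>0 int) set \<Rightarrow> 'f set" where
  "divisors x = {a \<in> carrier F. \<forall>s\<in>carrier R. \<exists>u\<in>carrier R. x \<otimes>\<^bsub>T\<^esub> t s \<one> = t u a}"

definition filter_qv_ext :: "('r \<times> 'f \<Rightarrow>\<^sub>0 int) set \<Rightarrow> 'g cut with_top" where
  "filter_qv_ext x = (if x = \<zero>\<^bsub>T\<^esub> then Top else Fin (cut_plus (Fin -` (v ` divisors x))))"

section \<open>Closure properties of the sets of divisors\<close>

lemma divisors_closed: "a \<in> divisors x \<Longrightarrow> a \<in> carrier F"
  by (simp add: divisors_def)

lemma divisors_mult:
  assumes "x \<in> carrier T" "y \<in> carrier T" "a \<in> divisors x" "b \<in> divisors y"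
  shows "a \<otimes> b \<in> divisors (x \<otimes>\<^bsub>T\<^esub> y)"
proof -
  have ab: "a \<in> carrier F" "b \<in> carrier F" using assms divisors_closed by auto
  have "\<exists>u\<in>carrier R. (x \<otimes>\<^bsub>T\<^esub> y) \<otimes>\<^bsub>T\<^esub> t s \<one> = t u (a \<otimes> b)" if s: "s \<in> carrier R" for s
  proof -
    obtain u where u: "u \<in> carrier R" "y \<otimes>\<^bsub>T\<^esub> t s \<one> = t u b"
      using assms s unfolding divisors_def by auto
    obtain u' where u': "u' \<in> carrier R" "x \<otimes>\<^bsub>T\<^esub> t u \<one> = t u' a"
      using assms u unfolding divisors_def by auto
    have "(x \<otimes>\<^bsub>T\<^esub> y) \<otimes>\<^bsub>T\<^esub> t s \<one> = x \<otimes>\<^bsub>T\<^esub> t u b"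
      using assms s u by (simp add: T.m_assoc)
    \<comment> \<open>Splitting off \<open>b\<close> as a right factor leaves \<open>x\<close> next
      to an element of \<open>R\<close>, where \<open>a \<in> divisors x\<close> applies.\<close>
    also have "t u b = t u \<one> \<otimes>\<^bsub>T\<^esub> t \<one>\<^bsub>R\<^esub> b"
      using u ab by (simp add: t_mult)
    also have "x \<otimes>\<^bsub>T\<^esub> (t u \<one> \<otimes>\<^bsub>T\<^esub> t \<one>\<^bsub>R\<^esub> b) = t u' a \<otimes>\<^bsub>T\<^esub> t \<one>\<^bsub>R\<^esub> b"
      using assms u u' ab by (simp flip: T.m_assoc)
    also have "\<dots> = t u' (a \<otimes> b)"
      using u' ab by (simp add: t_mult)
    finally show ?thesis using u' by blast
  qed
  with ab show ?thesis unfolding divisors_def by blast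
qed

text \<open>The quotient of \<open>b\<close> by \<open>a\<close> lies in the valuation ring, so it
  can be moved across the tensor sign and absorbed into \<open>R\<close>, which leaves
  \<open>a\<close> on the right.\<close>

lemma divisors_mono:
  assumes "a \<in> carrier F" "a \<noteq> \<zero>" "v a \<le> v b" "b \<in> divisors x"
  shows "a \<in> divisors x"
proof -
  have b: "b \<in> carrier F" using assms divisors_closed by auto
  note q = val_divide_nonneg[OF assms(1) b assms(2,3)]
  have "t u b = t ((b \<otimes> inv a) \<odot>\<^bsub>R\<^esub> u) a" if "u \<in> carrier R" for u
    using q that assms by (simp add: t_smult)
  moreover have "(b \<otimes> inv a) \<odot>\<^bsub>R\<^esub> u \<in> carrier R" if "u \<in> carrier R" for u
    using q that by (intro R.smult_closed) auto
  ultimately have "\<exists>u'\<in>carrier R. t u b = t u' a" if "u \<in> carrier R" for u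
    using that by blast
  moreover have "\<exists>u\<in>carrier R. x \<otimes>\<^bsub>T\<^esub> t s \<one> = t u b" if "s \<in> carrier R" for s
    using assms(4) that unfolding divisors_def by blast
  ultimately have "\<exists>u\<in>carrier R. x \<otimes>\<^bsub>T\<^esub> t s \<one> = t u a" if "s \<in> carrier R" for s
    using that by metis
  with assms(1) show ?thesis unfolding divisors_def by blast
qed

lemma divisors_add:
  assumes "x \<in> carrier T" "y \<in> carrier T" "a \<in> divisors x" "a \<in> divisors y"
  shows "a \<in> divisors (x \<oplus>\<^bsub>T\<^esub> y)"
proof -
  have a: "a \<in> carrier F" using assms divisors_closed by auto
  have "\<exists>u\<in>carrier R. (x \<oplus>\<^bsub>T\<^esub> y) \<otimes>\<^bsub>T\<^esub> t s \<one> = t u a" if s: "s \<in> carrier R" for s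
  proof -
    obtain p q where "p \<in> carrier R" "q \<in> carrier R" "x \<otimes>\<^bsub>T\<^esub> t s \<one> = t p a" "y \<otimes>\<^bsub>T\<^esub> t s \<one> = t q a"
      using assms s unfolding divisors_def by blast
    then show ?thesis
      using assms s a by (intro bexI[of _ "p \<oplus>\<^bsub>R\<^esub> q"]) (simp_all add: T.l_distr t_add)
  qed
  with a show ?thesis unfolding divisors_def by blast
qed

section \<open>The extended quasi-valuation and its ring of nonnegative elements\<close>

lemma quasi_valuation_filter_qv_ext: "quasi_valuation T filter_qv_ext"
  unfolding quasi_valuation_def
proof (intro conjI ballI)
  show "filter_qv_ext \<zero>\<^bsub>T\<^esub> = Top" by (simp add: filter_qv_ext_def)
next
  fix x y assume xy: "x \<in> carrier T" "y \<in> carrier T"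
  show "filter_qv_ext x + filter_qv_ext y \<le> filter_qv_ext (x \<otimes>\<^bsub>T\<^esub> y)"
  \<comment> \<open>Comparing cuts requires all three elements to be nonzero. In the other cases the
    product is zero and the right-hand side is \<open>Top\<close>.\<close>
  proof (cases "x = \<zero>\<^bsub>T\<^esub> \<or> y = \<zero>\<^bsub>T\<^esub> \<or> x \<otimes>\<^bsub>T\<^esub> y = \<zero>\<^bsub>T\<^esub>")
    case True
    then show ?thesis using xy by (auto simp: filter_qv_ext_def)
  next
    case False
    have "cut_plus (Fin -` (v ` divisors x)) + cut_plus (Fin -` (v ` divisors y))
        \<le> cut_plus (Fin -` (v ` divisors (x \<otimes>\<^bsub>T\<^esub> y)))"
      unfolding less_eq_cut_def cut_left_plus
    proof clarify
      fix \<alpha> \<beta>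
      assume "\<alpha> \<in> cut_left (cut_plus (Fin -` (v ` divisors x)))"
        and "\<beta> \<in> cut_left (cut_plus (Fin -` (v ` divisors y)))"
      then obtain a b \<gamma> \<delta> where ab: "a \<in> divisors x" "b \<in> divisors y" "v a = Fin \<gamma>" "v b = Fin \<delta>"
        and le: "\<alpha> \<le> \<gamma>" "\<beta> \<le> \<delta>"
        unfolding mem_cut_plus_vimage_Fin by auto
      have "v (a \<otimes> b) = Fin (\<gamma> + \<delta>)"
        using ab val_mult[of a b] by (simp add: divisors_closed)
      then show "\<alpha> + \<beta> \<in> cut_left (cut_plus (Fin -` (v ` divisors (x \<otimes>\<^bsub>T\<^esub> y))))"
        unfolding mem_cut_plus_vimage_Fin
        using divisors_mult[OF xy ab(1,2)] add_mono[OF le] by blast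
    qed
    with False show ?thesis by (simp add: filter_qv_ext_def)
  qed
  show "min (filter_qv_ext x) (filter_qv_ext y) \<le> filter_qv_ext (x \<oplus>\<^bsub>T\<^esub> y)"
  proof (cases "x = \<zero>\<^bsub>T\<^esub> \<or> y = \<zero>\<^bsub>T\<^esub> \<or> x \<oplus>\<^bsub>T\<^esub> y = \<zero>\<^bsub>T\<^esub>")
    case True
    then show ?thesis
      using xy by (auto simp: filter_qv_ext_def)
  next
    case False
    have "\<alpha> \<in> cut_left (cut_plus (Fin -` (v ` divisors (x \<oplus>\<^bsub>T\<^esub> y))))"
      if \<alpha>: "\<alpha> \<in> cut_left (cut_plus (Fin -` (v ` divisors x)))"
        and \<alpha>': "\<alpha> \<in> cut_left (cut_plus (Fin -` (v ` divisors y)))" for \<alpha>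
    proof -
      obtain a \<gamma> where a: "a \<in> divisors x" "v a = Fin \<gamma>" "\<alpha> \<le> \<gamma>"
        using \<alpha> unfolding mem_cut_plus_vimage_Fin by blast
      obtain b \<delta> where b: "b \<in> divisors y" "v b = Fin \<delta>" "\<alpha> \<le> \<delta>"
        using \<alpha>' unfolding mem_cut_plus_vimage_Fin by blast
      have "a \<in> carrier F" "b \<in> carrier F"
        using a(1) b(1) by (simp_all add: divisors_closed)
      moreover have "a \<noteq> \<zero>" "b \<noteq> \<zero>"
        using a(2) b(2) by auto
      \<comment> \<open>Whichever of \<open>a\<close> and \<open>b\<close> has the smaller value is
        a divisor of both summands by \<open>divisors_mono\<close>, hence of the sum. Either one is
        good enough, as \<open>\<alpha>\<close> lies below both values.\<close>
      ultimately have "a \<in> divisors (x \<oplus>\<^bsub>T\<^esub> y) \<or> b \<in> divisors (x \<oplus>\<^bsub>T\<^esub> y)"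
        using divisors_add[OF xy a(1) divisors_mono[OF _ _ _ b(1)]]
          divisors_add[OF xy divisors_mono[OF _ _ _ a(1)] b(1)] linear[of "v a" "v b"] by metis
      then show ?thesis
        unfolding mem_cut_plus_vimage_Fin using a(2,3) b(2,3) by metis
    qed
    \<comment> \<open>The minimum lies below both cuts, so each element of its left part belongs to
      both left parts.\<close>
    then have "min (cut_plus (Fin -` (v ` divisors x))) (cut_plus (Fin -` (v ` divisors y)))
        \<le> cut_plus (Fin -` (v ` divisors (x \<oplus>\<^bsub>T\<^esub> y)))"
      using min.cobounded1[of "cut_plus (Fin -` (v ` divisors x))" "cut_plus (Fin -` (v ` divisors y))"]
        min.cobounded2[of "cut_plus (Fin -` (v ` divisors x))" "cut_plus (Fin -` (v ` divisors y))"]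
      unfolding less_eq_cut_def subset_iff by simp
    with False show ?thesis by (simp add: filter_qv_ext_def min_def split: if_splits)
  qed
qed

lemma one_mem_divisors: "r \<in> carrier R \<Longrightarrow> \<one> \<in> divisors (t r \<one>)"
  unfolding divisors_def by (auto simp: t_mult)

lemma filter_qv_ext_extends:
  assumes r: "r \<in> carrier R"
  shows "filter_qv_ext (t r \<one>) = filter_qv F v R r"
proof (cases "r = \<zero>\<^bsub>R\<^esub>")
  case True
  then show ?thesis by (simp add: t_zero filter_qv_ext_def filter_qv_def)
next
  case False
  let ?S = "filter_set (valuation_ring F v) R r"
  \<comment> \<open>By injectivity a nonzero \<open>r\<close> stays nonzero, so both functions are
    given by their cuts.\<close>
  have nz: "t r \<one> \<noteq> \<zero>\<^bsub>T\<^esub>"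
    using pure_tensor_inject[OF r, of "\<zero>\<^bsub>R\<^esub>"] False by (auto simp: t_zero)
  have 1: "a \<in> divisors (t r \<one>)" if "a \<in> ?S" for a
    using that r unfolding filter_set_def divisors_def by (force simp: t_mult t_smult)
  \<comment> \<open>For integral \<open>a\<close> the scalar moves to the left factor, and
    injectivity pulls the resulting equation back to \<open>R\<close>.\<close>
  have 2: "a \<in> ?S" if "a \<in> divisors (t r \<one>)" "0 \<le> v a" for a
  proof -
    have a: "a \<in> carrier F" using that unfolding divisors_def by auto
    have "\<exists>u\<in>carrier R. r \<otimes>\<^bsub>R\<^esub> s = a \<odot>\<^bsub>R\<^esub> u" if s: "s \<in> carrier R" for s
    proof -
      obtain u where u: "u \<in> carrier R" "t r \<one> \<otimes>\<^bsub>T\<^esub> t s \<one> = t u a"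
        using \<open>a \<in> divisors (t r \<one>)\<close> s unfolding divisors_def by blast
      then have "t (r \<otimes>\<^bsub>R\<^esub> s) \<one> = t (a \<odot>\<^bsub>R\<^esub> u) \<one>"
        using r s a \<open>0 \<le> v a\<close> by (simp add: t_mult t_smult)
      then have "r \<otimes>\<^bsub>R\<^esub> s = a \<odot>\<^bsub>R\<^esub> u"
        using r s u a \<open>0 \<le> v a\<close> by (intro pure_tensor_inject) auto
      with u show ?thesis by blast
    qed
    with a that show ?thesis unfolding filter_set_def by auto
  qed
  have "r \<otimes>\<^bsub>R\<^esub> s \<in> (\<odot>\<^bsub>R\<^esub>) \<one> ` carrier R" if "s \<in> carrier R" for s
    using r that R.smult_one[of "r \<otimes>\<^bsub>R\<^esub> s"] by (intro image_eqI[of _ _ "r \<otimes>\<^bsub>R\<^esub> s"]) simp_all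
  then have 3: "\<one> \<in> ?S"
    unfolding filter_set_def by auto
  have "cut_plus (Fin -` (v ` divisors (t r \<one>))) = cut_plus (Fin -` (v ` ?S))"
    unfolding cut_left_inject[symmetric]
  proof (intro equalityI subsetI)
    fix \<alpha> assume "\<alpha> \<in> cut_left (cut_plus (Fin -` (v ` divisors (t r \<one>))))"
    then obtain a \<gamma> where a: "a \<in> divisors (t r \<one>)" "v a = Fin \<gamma>" "\<alpha> \<le> \<gamma>"
      unfolding mem_cut_plus_vimage_Fin by blast
    show "\<alpha> \<in> cut_left (cut_plus (Fin -` (v ` ?S)))"
    proof (cases "0 \<le> \<gamma>")
      case True
      with a 2[of a] show ?thesis
        unfolding mem_cut_plus_vimage_Fin by (auto simp: zero_with_top_def)
    next
      case False
      \<comment> \<open>Here \<open>\<alpha>\<close> lies below a negative value, hence below the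
        value 0 of \<open>\<one>\<close>, which replaces \<open>a\<close> as witness.\<close>
      with a 3 show ?thesis
        unfolding mem_cut_plus_vimage_Fin
        by (intro bexI[of _ \<one>] exI[of _ 0]) (auto simp: zero_with_top_def)
    qed
  qed (use 1 in \<open>auto simp: mem_cut_plus_vimage_Fin\<close>)
  with nz False show ?thesis
    by (simp add: filter_qv_ext_def filter_qv_def)
qed

lemma filter_qv_ext_nonneg:
  assumes x: "x \<in> carrier T"
  shows "0 \<le> filter_qv_ext x \<longleftrightarrow> x \<in> (\<lambda>r. t r \<one>) ` carrier R"
proof (cases "x = \<zero>\<^bsub>T\<^esub>")
  case True
  then show ?thesis
    by (auto simp: filter_qv_ext_def t_zero intro: rev_image_eqI[of "\<zero>\<^bsub>R\<^esub>"])
next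
  case nz: False
  \<comment> \<open>The zero cut has left part \<open>{..0}\<close>, and left parts are downward
    closed, so it is enough to test the element 0.\<close>
  have "0 \<le> filter_qv_ext x \<longleftrightarrow> 0 \<in> cut_left (cut_plus (Fin -` (v ` divisors x)))"
    using nz by (auto simp: filter_qv_ext_def zero_with_top_def[where ?'a = "'g cut"]
        less_eq_cut_def cut_left_zero intro: cut_left_down)
  also have "\<dots> \<longleftrightarrow> (\<exists>a\<in>divisors x. \<exists>\<gamma>. v a = Fin \<gamma> \<and> 0 \<le> \<gamma>)"
    by (rule mem_cut_plus_vimage_Fin)
  also have "\<dots> \<longleftrightarrow> x \<in> (\<lambda>r. t r \<one>) ` carrier R"
  proof
    assume "\<exists>a\<in>divisors x. \<exists>\<gamma>. v a = Fin \<gamma> \<and> 0 \<le> \<gamma>"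
    then obtain a where a: "a \<in> divisors x" "0 \<le> v a"
      by (auto simp: zero_with_top_def)
    \<comment> \<open>The divisor condition is taken at \<open>s = \<one>\<close>, where the product
      is \<open>x\<close> itself.\<close>
    then obtain u where u: "a \<in> carrier F" "u \<in> carrier R" "x \<otimes>\<^bsub>T\<^esub> t \<one>\<^bsub>R\<^esub> \<one> = t u a"
      unfolding divisors_def by blast
    then have "x = t (a \<odot>\<^bsub>R\<^esub> u) \<one>" using x a by (simp add: t_one t_smult)
    moreover have "a \<odot>\<^bsub>R\<^esub> u \<in> carrier R" using u a by auto
    ultimately show "x \<in> (\<lambda>r. t r \<one>) ` carrier R" by blast
  next
    assume "x \<in> (\<lambda>r. t r \<one>) ` carrier R"
    then show "\<exists>a\<in>divisors x. \<exists>\<gamma>. v a = Fin \<gamma> \<and> 0 \<le> \<gamma>"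
      using one_mem_divisors by (auto simp: zero_with_top_def intro!: bexI[of _ \<one>])
  qed
  finally show ?thesis .
qed

end

theorem theorem9p32:
  fixes F :: "('f, 'k) ring_scheme"
    and v :: "'f \<Rightarrow> 'g::linordered_ab_group_add with_top"
    and R :: "('f, 'r, 'm) module_scheme"
  assumes "valuation F v"
    and "assoc_algebra (valuation_ring F v) R"
    and "torsion_free (valuation_ring F v) R"
  shows "let T = tensor_algebra (valuation_ring F v) R (self_module F);
             \<iota> = (\<lambda>r. pure_tensor (valuation_ring F v) R (self_module F) r \<one>\<^bsub>F\<^esub>)
         in \<exists>W :: ('r \<times> 'f \<Rightarrow>\<^sub>0 int) set \<Rightarrow> 'g cut with_top.
              quasi_valuation T W \<and>
              (\<forall>r\<in>carrier R. W (\<iota> r) = filter_qv F v R r) \<and>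
              {x \<in> carrier T. 0 \<le> W x} = \<iota> ` carrier R"
proof -
  interpret torsion_free_valuation_algebra F v R
    using assms by (intro torsion_free_valuation_algebra.intro
        torsion_free_valuation_algebra_axioms.intro)
  show ?thesis
    unfolding Let_def
  proof (intro exI[of _ filter_qv_ext] conjI ballI)
    show "{x \<in> carrier T. 0 \<le> filter_qv_ext x} = (\<lambda>r. t r \<one>\<^bsub>F\<^esub>) ` carrier R"
      using filter_qv_ext_nonneg t_closed[OF _ one_closed] by blast
  qed (simp_all only: quasi_valuation_filter_qv_ext filter_qv_ext_extends)
qed

end
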